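(* Let $\mathcal{H}_n=\{x\in\mathbb{R}^n: 0\le x_i\le1\ \forall i\in[n]\}$ be the $n$-dimensional hypercube, and fix $x_0\in\mathcal{H}_n$ and $w\in\mathbb{R}^n$. Then the projections curve $g(\lambda)=\Pi_{\mathcal{H}_n}(x_0-\lambda w)$ has only $O(n)$ breakpoints (for $\lambda\ge0$).
   Context: $\Pi_{\mathcal{H}_n}$ is Euclidean projection onto $\mathcal{H}_n$. The curve $g$ is continuous and piecewise affine in $\lambda$; its breakpoints are the successive end points of the maximal $\lambda$-intervals on which $g$ is affine and non-constant. The $O(\cdot)$ constant is absolute. *)

theory Defs
  imports "HOL-Analysis.Analysis"
begin

(* A vector in R^n is a function in topspace (Euclidean_space n): its coordinates are indexed by
   0, ..., n - 1, and it is 0 at every index from n on. The dimension is thus a term, so that a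
   constant can be chosen before n. *)

definition hypercube :: "nat \<Rightarrow> (nat \<Rightarrow> real) set" where
  "hypercube n = {x \<in> topspace (Euclidean_space n). \<forall>i<n. 0 \<le> x i \<and> x i \<le> 1}"

definition euclidean_dist :: "nat \<Rightarrow> (nat \<Rightarrow> real) \<Rightarrow> (nat \<Rightarrow> real) \<Rightarrow> real" where
  "euclidean_dist n x y = L2_set (\<lambda>i. x i - y i) {..<n}"

(* The counterpart of closest_point for this representation of R^n. *)
definition euclidean_projection ::
    "nat \<Rightarrow> (nat \<Rightarrow> real) set \<Rightarrow> (nat \<Rightarrow> real) \<Rightarrow> (nat \<Rightarrow> real)" where
  "euclidean_projection n S a =
     (SOME x. x \<in> S \<and> (\<forall>y\<in>S. euclidean_dist n a x \<le> euclidean_dist n a y))"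

definition projections_curve ::
    "nat \<Rightarrow> (nat \<Rightarrow> real) \<Rightarrow> (nat \<Rightarrow> real) \<Rightarrow> real \<Rightarrow> (nat \<Rightarrow> real)" where
  "projections_curve n x0 w t = euclidean_projection n (hypercube n) (\<lambda>i. x0 i - t * w i)"

definition affine_curve_on :: "real set \<Rightarrow> (real \<Rightarrow> nat \<Rightarrow> real) \<Rightarrow> bool" where
  "affine_curve_on I g \<longleftrightarrow> (\<exists>a b. \<forall>t\<in>I. g t = (\<lambda>i. a i + t * b i))"

definition affine_nonconstant_interval :: "(real \<Rightarrow> nat \<Rightarrow> real) \<Rightarrow> real set \<Rightarrow> bool" where
  "affine_nonconstant_interval g I \<longleftrightarrow>
     is_interval I \<and> I \<subseteq> {0..} \<and> affine_curve_on I g \<and> \<not> g constant_on I"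

definition maximal_affine_interval :: "(real \<Rightarrow> nat \<Rightarrow> real) \<Rightarrow> real set \<Rightarrow> bool" where
  "maximal_affine_interval g I \<longleftrightarrow>
     affine_nonconstant_interval g I \<and>
     (\<forall>J. affine_nonconstant_interval g J \<and> I \<subseteq> J \<longrightarrow> J = I)"

(* The frontier of an interval, taken in the real line, is the set of its finite end points,
   whether or not they belong to the interval. Left end points, and hence possibly 0, count. *)
definition breakpoints :: "(real \<Rightarrow> nat \<Rightarrow> real) \<Rightarrow> real set" where
  "breakpoints g = (\<Union>I\<in>{I. maximal_affine_interval g I}. frontier I)"

end

theory Submission
  imports Defs
begin

text \<open>
  The squared distance to a point of the cube is a sum over coordinates, so projecting onto it
  means clamping every coordinate to \<open>[0, 1]\<close> separately
  (\<open>euclidean_projection_hypercube\<close>). Along the curve, coordinate \<open>i\<close> is therefore the clamped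
  affine function \<open>x0 i - t * w i\<close>, and this is affine near every parameter except those at which
  it crosses one of the two walls \<open>0\<close> and \<open>1\<close>. Each coordinate contributes at most two such
  parameters, so away from a set of at most \<open>2 * n\<close> parameters the whole curve is locally affine
  (\<open>projections_curve_locally_affine\<close>).

  At a positive parameter where a curve is locally affine no maximal affine interval can end: two
  affine pieces that share two points coincide, so the interval could be prolonged past its end
  (\<open>breakpoints_subset_nonaffine\<close>). Together with the parameter \<open>0\<close>, where the domain of the
  curve ends, this leaves at most \<open>2 * n + 1\<close> breakpoints, which is at most \<open>3 * n\<close> for positive
  \<open>n\<close>. In dimension \<open>0\<close> the curve is constant and there is none.
\<close>

definition clamp01 :: "real \<Rightarrow> real" where
  "clamp01 u = max 0 (min 1 u)"

text \<open>
  Clamping is at least as good as any other point in every single coordinate, which makes it a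
  minimiser; in a coordinate where another point differs from it, it is strictly better, which
  makes it the only one, and hence the point that the choice operator picks.
\<close>

lemma euclidean_projection_hypercube:
  "euclidean_projection n (hypercube n) a = (\<lambda>i. if i < n then clamp01 (a i) else 0)"
proof -
  define c where "c = (\<lambda>i. if i < n then clamp01 (a i) else 0)"
  have c_in: "c \<in> hypercube n"
    by (auto simp: hypercube_def c_def topspace_Euclidean_space clamp01_def)
  have closer: "(a i - c i)\<^sup>2 \<le> (a i - y i)\<^sup>2" if "y \<in> hypercube n" "i < n" for y i
  proof -
    have "0 \<le> y i" "y i \<le> 1" using that by (auto simp: hypercube_def)
    then have "\<bar>a i - c i\<bar> \<le> \<bar>a i - y i\<bar>"
      using that(2) by (auto simp: c_def clamp01_def)
    then show ?thesis by (simp add: abs_le_square_iff)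
  qed
  have strictly_closer: "(a i - c i)\<^sup>2 < (a i - y i)\<^sup>2"
    if "y \<in> hypercube n" "i < n" "y i \<noteq> c i" for y i
  proof -
    have "0 \<le> y i" "y i \<le> 1" using that by (auto simp: hypercube_def)
    then have "\<bar>a i - c i\<bar> < \<bar>a i - y i\<bar>"
      using that(2,3) by (auto simp: c_def clamp01_def max_def min_def split: if_splits)
    then show ?thesis by (metis abs_le_square_iff not_le)
  qed
  have minimal: "euclidean_dist n a c \<le> euclidean_dist n a y" if "y \<in> hypercube n" for y
    unfolding euclidean_dist_def L2_set_def
    using closer[OF that] by (intro real_sqrt_le_mono sum_mono) auto
  have unique: "x = c"
    if x: "x \<in> hypercube n" and le: "euclidean_dist n a x \<le> euclidean_dist n a c" for x
  proof (rule ccontr)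
    assume "x \<noteq> c"
    then obtain i where i: "x i \<noteq> c i" by auto
    with x have "i < n"
      by (cases "i < n") (auto simp: c_def hypercube_def topspace_Euclidean_space)
    then have "(\<Sum>i<n. (a i - c i)\<^sup>2) < (\<Sum>i<n. (a i - x i)\<^sup>2)"
      using closer[OF x] strictly_closer[OF x _ i] by (intro sum_strict_mono_ex1) auto
    with le show False by (simp add: euclidean_dist_def L2_set_def)
  qed
  have "euclidean_projection n (hypercube n) a = c"
    unfolding euclidean_projection_def using c_in minimal unique by (intro some_equality) auto
  then show ?thesis by (simp add: c_def)
qed

lemma clamp01_locally_affine:
  assumes "v = 0 \<or> u - p * v \<notin> {0, 1}"
  shows "\<exists>a b. \<forall>\<^sub>F t in nhds p. clamp01 (u - t * v) = a + t * b"
proof -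
  have lim: "((\<lambda>t. u - t * v) \<longlongrightarrow> u - p * v) (nhds p)"
    by (intro tendsto_intros filterlim_ident)
  consider "v = 0" | "u - p * v < 0" | "0 < u - p * v" "u - p * v < 1" | "1 < u - p * v"
    using assms by fastforce
  then show ?thesis
  proof cases
    case 1
    then show ?thesis
      by (intro exI[of _ "clamp01 u"] exI[of _ 0]) simp
  next
    case 2
    from order_tendstoD(2)[OF lim this] have "\<forall>\<^sub>F t in nhds p. clamp01 (u - t * v) = 0 + t * 0"
      by eventually_elim (simp add: clamp01_def)
    then show ?thesis by blast
  next
    case 3
    from order_tendstoD(1)[OF lim 3(1)] order_tendstoD(2)[OF lim 3(2)]
    have "\<forall>\<^sub>F t in nhds p. clamp01 (u - t * v) = u + t * (- v)"
      by eventually_elim (simp add: clamp01_def)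
    then show ?thesis by blast
  next
    case 4
    from order_tendstoD(1)[OF lim this] have "\<forall>\<^sub>F t in nhds p. clamp01 (u - t * v) = 1 + t * 0"
      by eventually_elim (simp add: clamp01_def)
    then show ?thesis by blast
  qed
qed

text \<open>
  The parameters at which some coordinate meets a wall. A coordinate with \<open>w i = 0\<close> stays put; for
  it the two quotients are \<open>0\<close>, a value that has to be counted anyway.
\<close>

definition wall_times :: "nat \<Rightarrow> (nat \<Rightarrow> real) \<Rightarrow> (nat \<Rightarrow> real) \<Rightarrow> real set" where
  "wall_times n x0 w = (\<lambda>i. x0 i / w i) ` {..<n} \<union> (\<lambda>i. (x0 i - 1) / w i) ` {..<n}"

lemma finite_wall_times: "finite (wall_times n x0 w)"
  by (simp add: wall_times_def)

lemma card_wall_times_le: "card (wall_times n x0 w) \<le> 2 * n"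
proof -
  have "card (wall_times n x0 w) \<le>
      card ((\<lambda>i. x0 i / w i) ` {..<n}) + card ((\<lambda>i. (x0 i - 1) / w i) ` {..<n})"
    unfolding wall_times_def by (rule card_Un_le)
  also have "\<dots> \<le> n + n"
    by (intro add_mono card_image_le[THEN order_trans]) auto
  finally show ?thesis by simp
qed

lemma projections_curve_locally_affine:
  assumes "p \<notin> wall_times n x0 w"
  shows "\<exists>e>0. affine_curve_on (ball p e) (projections_curve n x0 w)"
proof -
  have "\<exists>a b. \<forall>\<^sub>F t in nhds p. clamp01 (x0 i - t * w i) = a + t * b" if "i < n" for i
  proof (rule clamp01_locally_affine)
    have "p \<noteq> x0 i / w i" "p \<noteq> (x0 i - 1) / w i"
      using assms that by (auto simp: wall_times_def)
    then show "w i = 0 \<or> x0 i - p * w i \<notin> {0, 1}"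
      by (auto simp: field_simps)
  qed
  then obtain a b where
    ab: "\<forall>\<^sub>F t in nhds p. clamp01 (x0 i - t * w i) = a i + t * b i" if "i < n" for i
    by metis
  have "\<forall>\<^sub>F t in nhds p. \<forall>i\<in>{..<n}. clamp01 (x0 i - t * w i) = a i + t * b i"
    using ab by (intro eventually_ball_finite) auto
  then obtain e where e: "e > 0"
    "\<And>t i. dist t p < e \<Longrightarrow> i < n \<Longrightarrow> clamp01 (x0 i - t * w i) = a i + t * b i"
    unfolding eventually_nhds_metric by auto
  have "affine_curve_on (ball p e) (projections_curve n x0 w)"
    unfolding affine_curve_on_def
    by (intro exI[of _ "\<lambda>i. if i < n then a i else 0"] exI[of _ "\<lambda>i. if i < n then b i else 0"])
      (auto simp: projections_curve_def euclidean_projection_hypercube e(2) dist_commute)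
  with e(1) show ?thesis by blast
qed

lemma affine_curve_on_Un:
  assumes I: "affine_curve_on I g" and J: "affine_curve_on J g"
    and cd: "c \<in> I \<inter> J" "d \<in> I \<inter> J" "c \<noteq> d"
  shows "affine_curve_on (I \<union> J) g"
proof -
  from I obtain a b where ab: "g t = (\<lambda>i. a i + t * b i)" if "t \<in> I" for t
    unfolding affine_curve_on_def by blast
  from J obtain a' b' where ab': "g t = (\<lambda>i. a' i + t * b' i)" if "t \<in> J" for t
    unfolding affine_curve_on_def by blast
  have "a i = a' i \<and> b i = b' i" for i
  proof -
    have at_c: "a i + c * b i = a' i + c * b' i"
      using ab[of c] ab'[of c] cd by (metis IntE)
    moreover have "a i + d * b i = a' i + d * b' i"
      using ab[of d] ab'[of d] cd by (metis IntE)
    ultimately have "(c - d) * (b i - b' i) = 0" by (simp add: algebra_simps)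
    with cd(3) at_c show ?thesis by simp
  qed
  then have "a = a'" "b = b'" by auto
  then show ?thesis
    unfolding affine_curve_on_def using ab ab' by blast
qed

text \<open>
  The interior of an interval with two points is dense in it, so every neighbourhood of an end
  point contains a whole ball of the interval.
\<close>

lemma interval_two_points_near_closure:
  fixes I :: "real set"
  assumes "is_interval I" "x \<in> I" "y \<in> I" "x \<noteq> y" "p \<in> closure I" "e > 0"
  obtains c d where "c \<in> I \<inter> ball p e" "d \<in> I \<inter> ball p e" "c \<noteq> d"
proof -
  have seg: "{min x y<..<max x y} \<subseteq> I"
  proof
    fix z assume "z \<in> {min x y<..<max x y}"
    then show "z \<in> I"
      using mem_is_interval_1_I[OF assms(1), of "min x y" "max x y" z] assms(2,3)
      by (auto simp: min_def max_def split: if_splits)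
  qed
  have "{min x y<..<max x y} \<noteq> {}"
    using assms(4) by simp
  with seg have "interior I \<noteq> {}"
    by (metis interior_maximal open_greaterThanLessThan subset_empty)
  moreover have "convex I" using assms(1) by (simp add: is_interval_convex)
  ultimately have "p \<in> closure (interior I)"
    using assms(5) convex_closure_interior by blast
  then obtain c where c: "c \<in> interior I" "dist c p < e"
    using assms(6) by (auto simp: closure_approachable)
  then have "c \<in> interior I \<inter> ball p e" by (simp add: dist_commute)
  moreover have "open (interior I \<inter> ball p e)" by auto
  ultimately obtain r where r: "r > 0" "ball c r \<subseteq> interior I \<inter> ball p e"
    using open_contains_ball by blast
  then have "c \<in> I \<inter> ball p e" "c + r / 2 \<in> I \<inter> ball p e" "c \<noteq> c + r / 2"
    using interior_subset[of I] by (auto simp: dist_real_def subset_iff)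
  then show ?thesis by (rule that)
qed

lemma breakpoints_subset_nonaffine:
  assumes loc: "\<And>p. p > 0 \<Longrightarrow> p \<notin> T \<Longrightarrow> \<exists>e>0. affine_curve_on (ball p e) g"
  shows "breakpoints g \<subseteq> insert 0 T"
proof
  fix p assume "p \<in> breakpoints g"
  then obtain I where max: "maximal_affine_interval g I" and p: "p \<in> frontier I"
    by (auto simp: breakpoints_def)
  from max have I: "is_interval I" "I \<subseteq> {0..}" "affine_curve_on I g" "\<not> g constant_on I"
    by (auto simp: maximal_affine_interval_def affine_nonconstant_interval_def)
  have p_cl: "p \<in> closure I" using p by (simp add: frontier_def)
  moreover have "closure I \<subseteq> {0..}" using I(2) by (simp add: closure_minimal)
  ultimately have "p \<ge> 0" by auto
  show "p \<in> insert 0 T"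
  proof (rule ccontr)
    assume not_in: "p \<notin> insert 0 T"
    with \<open>p \<ge> 0\<close> have "p > 0" by auto
    with not_in loc obtain e0 where e0: "e0 > 0" "affine_curve_on (ball p e0) g" by blast
    \<comment> \<open>The ball is shrunk so that it stays in the domain \<open>{0..}\<close> of the curve.\<close>
    define e where "e = min e0 p"
    have e: "e > 0" "ball p e \<subseteq> {0..}"
      using e0(1) \<open>p > 0\<close> by (auto simp: e_def dist_real_def)
    have aff: "affine_curve_on (ball p e) g"
      using e0(2) unfolding affine_curve_on_def e_def by (meson mem_ball min_less_iff_conj)
    obtain x y where xy: "x \<in> I" "y \<in> I" "g x \<noteq> g y"
      using I(4) unfolding constant_on_def by metis
    then obtain c d where cd: "c \<in> I \<inter> ball p e" "d \<in> I \<inter> ball p e" "c \<noteq> d"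
      using interval_two_points_near_closure[OF I(1) xy(1,2) _ p_cl e(1)] by metis
    have "connected (I \<union> ball p e)"
      using cd(1) I(1) by (intro connected_Un) (auto simp: is_interval_connected)
    then have "is_interval (I \<union> ball p e)" by (simp add: is_interval_connected_1)
    moreover have "affine_curve_on (I \<union> ball p e) g"
      using affine_curve_on_Un[OF I(3) aff cd] .
    moreover have "\<not> g constant_on (I \<union> ball p e)"
      using I(4) constant_on_subset by blast
    ultimately have "affine_nonconstant_interval g (I \<union> ball p e)"
      using I(2) e(2) by (simp add: affine_nonconstant_interval_def)
    with max have "I \<union> ball p e = I"
      unfolding maximal_affine_interval_def by blast
    then have "p \<in> interior I"
      using e(1) by (auto simp: mem_interior)
    with p show False by (simp add: frontier_def)
  qed
qed

text \<open>
  The bound \<open>2 * n + 1\<close> is not linear at \<open>n = 0\<close>, which therefore needs an argument of its own: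
  a constant curve has no affine and non-constant interval.
\<close>

lemma breakpoints_projections_curve_0: "breakpoints (projections_curve 0 x0 w) = {}"
proof -
  have "projections_curve 0 x0 w constant_on I" for I
    by (simp add: constant_on_def projections_curve_def euclidean_projection_hypercube)
  then show ?thesis
    by (simp add: breakpoints_def maximal_affine_interval_def affine_nonconstant_interval_def)
qed

theorem theorem5:
  shows "\<exists>C::real. \<forall>n. \<forall>x0\<in>hypercube n. \<forall>w\<in>topspace (Euclidean_space n).
           finite (breakpoints (projections_curve n x0 w)) \<and>
           real (card (breakpoints (projections_curve n x0 w))) \<le> C * real n"
proof (intro exI[of _ 3] allI ballI)
  fix n :: nat and x0 w :: "nat \<Rightarrow> real"
  let ?B = "breakpoints (projections_curve n x0 w)"
  have sub: "?B \<subseteq> insert 0 (wall_times n x0 w)"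
    by (intro breakpoints_subset_nonaffine projections_curve_locally_affine)
  have fin: "finite ?B"
    using sub finite_wall_times by (auto intro: finite_subset)
  have "card ?B \<le> card (insert 0 (wall_times n x0 w))"
    using sub finite_wall_times by (intro card_mono) auto
  also have "\<dots> \<le> Suc (card (wall_times n x0 w))"
    by (rule card_insert_le_m1) auto
  also have "\<dots> \<le> 2 * n + 1" using card_wall_times_le[of n x0 w] by simp
  finally have "card ?B \<le> 2 * n + 1" .
  moreover have "card ?B = 0" if "n = 0"
    using that by (simp add: breakpoints_projections_curve_0)
  ultimately have "card ?B \<le> 3 * n" by (cases n) auto
  then have "real (card ?B) \<le> 3 * real n" by linarith
  with fin show "finite ?B \<and> real (card ?B) \<le> 3 * real n" by simp
qed

end
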